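(* Let $\mathcal{M}$ be an MDP, $B$ a set of absorbing target states, $c$ a non-negative cost function and $\beta\in(0,1)$. Let $\widetilde{\pi}$ be a stationary deterministic policy on the cleaned-up MDP $\mathcal{M}'$ minimizing $J$ over $\Pi(\mathcal{M}')$, and let $\widetilde{\pi}'$ be the perturbed stationary policy with perturbation parameter $\epsilon'>0$ (all defined in the context). For any given $\epsilon>0$, the policy $\widetilde{\pi}'$ is an $\epsilon$-optimal policy, that is, $\widetilde{\pi}'\in\Xi(\mathcal{M},B)$ and $$J(\widetilde{\pi}')\leq\inf_{\pi\in\Xi(\mathcal{M},B)}J(\pi)+\epsilon,$$ if $\epsilon'>0$ is chosen such that $$\epsilon'\leq\frac{\epsilon}{\gamma_1+\gamma_2},$$ where $$\gamma_1:=\beta\boldsymbol{\alpha}^T(\mathbb{I}-\beta\mathcal{P}^{\widetilde{\pi}})^{-1}M(\mathbb{I}-\beta\mathcal{P}^{\widetilde{\pi}'})^{-1}\boldsymbol{c}^{\widetilde{\pi}},\qquad \gamma_2:=\boldsymbol{\alpha}^T(\mathbb{I}-\beta\mathcal{P}^{\widetilde{\pi}'})^{-1}\boldsymbol{v}.$$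
   Context: A Markov decision process (MDP) is a tuple $\mathcal{M}=(S,s_1,\mathcal{A},\mathcal{P})$ with $S$ a finite set of states, $s_1\in S$ an initial state, $\mathcal{A}$ a finite set of actions, $\mathcal{A}(s)\subseteq\mathcal{A}$ the set of actions available in $s$, and $\mathcal{P}:S\times\mathcal{A}\times S\to[0,1]$, written $\mathcal{P}_{s,a,s'}$, with $\sum_{s'\in S}\mathcal{P}_{s,a,s'}=1$ for all $s\in S$, $a\in\mathcal{A}(s)$. A state $s$ is absorbing if $\mathcal{P}_{s,a,s}=1$ for all $a\in\mathcal{A}(s)$. A policy is a sequence $\pi=(d_1,d_2,\ldots)$ of maps $d_t:S\times\mathcal{A}\to[0,1]$ with $\sum_{a\in\mathcal{A}(s)}d_t(s,a)=1$ for all $s$ (at step $t$ in state $s$ the agent takes action $a\in\mathcal{A}(s)$ with probability $d_t(s,a)$). It is stationary if all $d_t$ are equal (then write $\pi(s,a)$ for $d_1(s,a)$), and stationary deterministic if moreover for each $s$ some $a\in\mathcal{A}(s)$ has $\pi(s,a)=1$. $\Pi(\mathcal{M})$ is the set of all policies. $\Pr^{\pi}_{\mathcal{M}}(Reach[B])$ is the probability that the random path $s_1s_2\ldots$ generated under $\pi$ satisfies $s_t\in B$ for some $t\geq1$. $\Xi(\mathcal{M},B)$ is the set of policies attaining $\max_{\pi\in\Pi(\mathcal{M})}\Pr^{\pi}_{\mathcal{M}}(Reach[B])$. For a cost $c:S\times\mathcal{A}\to\mathbb{R}_{\geq0}$, $J(\pi)=\mathbb{E}^{\pi}\big[\sum_{t=1}^{\infty}\beta^{t-1}c(s_t,a_t)\big]$.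 Cleaned-up MDP. Let $x_s$ be the maximum, over all policies, of the probability of reaching $B$ from $s$ (so $x_s=1$ for $s\in B$, $x_s=0$ if $B$ cannot be reached from $s$ under any policy, and $x_s=\max_{a\in\mathcal{A}(s)}\sum_{s'}\mathcal{P}_{s,a,s'}x_{s'}$ otherwise). Let $\mathcal{A}_{\max}(s)=\{a\in\mathcal{A}(s): x_s=\sum_{s'}\mathcal{P}_{s,a,s'}x_{s'}\}$. The cleaned-up MDP $\mathcal{M}'$ is obtained from $\mathcal{M}$ by replacing the available actions $\mathcal{A}(s)$ by $\mathcal{A}_{\max}(s)$ for each $s$ (this changes nothing at states in $B$ or at states from which $B$ is unreachable). Perturbed policy. Given $\widetilde{\pi}$, a stationary deterministic policy of $\mathcal{M}'$ with $\widetilde{\pi}\in\arg\min_{\pi\in\Pi(\mathcal{M}')}J(\pi)$, let $\mathcal{A}_{act}(s)=\{a\in\mathcal{A}_{\max}(s):\widetilde{\pi}(s,a)>0\}$ and $\mathcal{A}_{pass}(s)=\mathcal{A}_{\max}(s)\setminus\mathcal{A}_{act}(s)$. Define the stationary policy $\widetilde{\pi}'$ of $\mathcal{M}'$ by $\widetilde{\pi}'(s,a)=\epsilon'$ if $a\in\mathcal{A}_{pass}(s)$ and $\widetilde{\pi}'(s,a)=\widetilde{\pi}(s,a)-\epsilon'\frac{|\mathcal{A}_{pass}(s)|}{|\mathcal{A}_{act}(s)|}$ if $a\in\mathcal{A}_{act}(s)$ (and $\widetilde{\pi}'(s,a)=0$ for $a\notin\mathcal{A}_{\max}(s)$), where $\epsilon'>0$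 is a sufficiently small constant such that $\widetilde{\pi}'(s,a)\geq0$ for all $s\in S$ and $a\in\mathcal{A}$. Matrices. For a stationary policy $\pi$ of $\mathcal{M}'$, $\mathcal{P}^{\pi}\in\mathbb{R}^{|S|\times|S|}$ has entries $\mathcal{P}^{\pi}_{s,s'}=\sum_{a\in\mathcal{A}_{\max}(s)}\pi(s,a)\mathcal{P}_{s,a,s'}$, and $\boldsymbol{c}^{\pi}\in\mathbb{R}^{|S|}$ has entries $c^{\pi}_s=\sum_{a\in\mathcal{A}_{\max}(s)}\pi(s,a)c(s,a)$. $\mathbb{I}$ is the identity matrix; $\boldsymbol{\alpha}\in\mathbb{R}^{|S|}$ has $\alpha_{s_1}=1$ and all other entries $0$. The matrix $M\in\mathbb{R}^{|S|\times|S|}$ and vector $\boldsymbol{v}=(v_s)_{s\in S}\in\mathbb{R}^{|S|}$ are $$M(s,s')=\sum_{a\in\mathcal{A}_{pass}(s)}\mathcal{P}_{s,a,s'}-\frac{|\mathcal{A}_{pass}(s)|}{|\mathcal{A}_{act}(s)|}\sum_{a\in\mathcal{A}_{act}(s)}\mathcal{P}_{s,a,s'},\qquad v_s=\sum_{a\in\mathcal{A}_{pass}(s)}c(s,a)-\frac{|\mathcal{A}_{pass}(s)|}{|\mathcal{A}_{act}(s)|}\sum_{a\in\mathcal{A}_{act}(s)}c(s,a).$$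
   Formalization: The perturbed policy is required to give strictly positive (not just nonnegative) probability to every action in A_max(s), i.e. ε'|A_pass(s)|<1 for all s; at equality it may drop the action of π̃ and never reach B, so the claim fails. *)

theory Defs
  imports "HOL-Probability.Probability"
begin

section \<open>Markov decision processes and policies\<close>

text \<open>
  The finite sets of states and of actions are finite types. The value of \<open>transition\<close> at
  actions outside \<open>actions M s\<close> is irrelevant: policies never choose them.
\<close>

record ('s, 'a) mdp =
  initial :: 's
  actions :: "'s \<Rightarrow> 'a set"
  transition :: "'s \<Rightarrow> 'a \<Rightarrow> 's pmf"

definition absorbing :: "('s, 'a) mdp \<Rightarrow> 's \<Rightarrow> bool" where
  "absorbing M s \<longleftrightarrow> (\<forall>a\<in>actions M s. pmf (transition M s a) s = 1)"

text \<open>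
  Policies are randomized and Markovian. Time starts at \<open>0\<close> here, so \<open>\<pi> t\<close> is the decision
  rule \<open>d\<^sub>t\<^sub>+\<^sub>1\<close>.
\<close>

type_synonym ('s, 'a) policy = "nat \<Rightarrow> 's \<Rightarrow> 'a pmf"

definition policies :: "('s, 'a) mdp \<Rightarrow> ('s, 'a) policy set" where
  "policies M = {\<pi>. \<forall>t s. set_pmf (\<pi> t s) \<subseteq> actions M s}"

abbreviation stationary :: "('s \<Rightarrow> 'a pmf) \<Rightarrow> ('s, 'a) policy" where
  "stationary d \<equiv> (\<lambda>t. d)"

definition deterministic :: "('s, 'a) mdp \<Rightarrow> ('s \<Rightarrow> 'a pmf) \<Rightarrow> bool" where
  "deterministic M d \<longleftrightarrow> (\<forall>s. \<exists>a\<in>actions M s. pmf (d s) a = 1)"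

section \<open>The random path\<close>

text \<open>
  \<open>step M s \<pi> t \<omega>\<close> is the law of the state-action pair at time \<open>t\<close> given the pairs
  \<open>\<omega> 0, \<dots>, \<omega> (t - 1)\<close>, for the process started in state \<open>s\<close>. The measure on infinite
  paths of state-action pairs is obtained from these kernels by the Ionescu-Tulcea theorem.
\<close>

definition step ::
  "('s, 'a) mdp \<Rightarrow> 's \<Rightarrow> ('s, 'a) policy \<Rightarrow> nat \<Rightarrow> (nat \<Rightarrow> 's \<times> 'a) \<Rightarrow> ('s \<times> 'a) measure" where
  "step M s \<pi> t \<omega> = measure_pmf (bind_pmf
     (if t = 0 then return_pmf s else case \<omega> (t - 1) of (s', a') \<Rightarrow> transition M s' a')
     (\<lambda>s'. map_pmf (Pair s') (\<pi> t s')))"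

lemma Ionescu_Tulcea_step:
  fixes M :: "('s::finite, 'a::finite) mdp"
  shows "Ionescu_Tulcea (step M s \<pi>) (\<lambda>_. count_space UNIV)"
proof (rule Ionescu_Tulcea.intro)
  fix i :: nat
  show "step M s \<pi> i \<in> measurable (PiM {0..<i} (\<lambda>_. count_space UNIV))
      (subprob_algebra (count_space UNIV))"
  proof (cases i)
    case 0
    then have "step M s \<pi> i = (\<lambda>_. measure_pmf (bind_pmf (return_pmf s)
        (\<lambda>s'. map_pmf (Pair s') (\<pi> 0 s'))))"
      by (simp add: step_def fun_eq_iff)
    then show ?thesis
      by (simp add: measure_pmf_in_subprob_algebra)
  next
    case (Suc n)
    define g where "g = (\<lambda>x. measure_pmf (bind_pmf (transition M (fst x) (snd x))
        (\<lambda>s'. map_pmf (Pair s') (\<pi> i s'))))"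
    have eq: "step M s \<pi> i = (\<lambda>\<omega>. g (\<omega> n))"
      by (simp add: step_def g_def Suc fun_eq_iff case_prod_beta)
    have g: "g \<in> measurable (count_space UNIV) (subprob_algebra (count_space UNIV))"
      by (simp add: g_def measure_pmf_in_subprob_algebra)
    have "(\<lambda>\<omega>. \<omega> n) \<in> measurable
        (PiM {0..<i} (\<lambda>_. count_space UNIV :: ('s \<times> 'a) measure)) (count_space UNIV)"
      by (rule measurable_component_singleton) (simp add: Suc)
    then show ?thesis
      unfolding eq by (rule measurable_compose) (rule g)
  qed
qed (simp add: step_def measure_pmf.prob_space_axioms)

definition path_measure ::
  "('s, 'a) mdp \<Rightarrow> 's \<Rightarrow> ('s, 'a) policy \<Rightarrow> (nat \<Rightarrow> 's \<times> 'a) measure" where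
  "path_measure M s \<pi> = projective_family.lim UNIV
     (Ionescu_Tulcea.CI (step M s \<pi>) (\<lambda>_. count_space UNIV)) (\<lambda>_. count_space UNIV)"

lemma prob_space_path_measure:
  fixes M :: "('s::finite, 'a::finite) mdp"
  shows "prob_space (path_measure M s \<pi>)"
proof -
  interpret Ionescu_Tulcea "step M s \<pi>" "\<lambda>_. count_space UNIV"
    by (rule Ionescu_Tulcea_step)
  have "emeasure PF.lim (PF.emb UNIV {} (space (PiM {} (\<lambda>_. count_space UNIV)))) =
      emeasure (CI {}) (space (PiM {} (\<lambda>_. count_space UNIV)))"
    by (rule lim) auto
  moreover have "PF.emb UNIV {} (space (PiM {} (\<lambda>_. count_space UNIV))) = space PF.lim"
    by (auto simp: prod_emb_def space_PiM restrict_def)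
  moreover have "emeasure (CI {}) (space (PiM {} (\<lambda>_. count_space UNIV))) = 1"
    using prob_space.emeasure_space_1[OF PF.prob_space_P[of "{}"]] by (simp add: CI_def)
  ultimately show ?thesis
    unfolding path_measure_def by (intro prob_spaceI) simp
qed

section \<open>Reachability and discounted cost\<close>

definition reach_prob ::
  "('s, 'a) mdp \<Rightarrow> 's \<Rightarrow> 's set \<Rightarrow> ('s, 'a) policy \<Rightarrow> real" where
  "reach_prob M s B \<pi> = \<P>(\<omega> in path_measure M s \<pi>. \<exists>t. fst (\<omega> t) \<in> B)"

definition reach_optimal :: "('s, 'a) mdp \<Rightarrow> 's set \<Rightarrow> ('s, 'a) policy set" where
  "reach_optimal M B =
     {\<pi>. is_arg_max (reach_prob M (initial M) B) (\<lambda>\<rho>. \<rho> \<in> policies M) \<pi>}"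

definition cost ::
  "('s, 'a) mdp \<Rightarrow> ('s \<Rightarrow> 'a \<Rightarrow> real) \<Rightarrow> real \<Rightarrow> ('s, 'a) policy \<Rightarrow> real" where
  "cost M c \<beta> \<pi> =
     (\<integral>\<omega>. (\<Sum>t. \<beta> ^ t * c (fst (\<omega> t)) (snd (\<omega> t))) \<partial>path_measure M (initial M) \<pi>)"

section \<open>The cleaned-up process\<close>

text \<open>The supremum is a maximum, since states and actions are finite.\<close>

definition max_reach :: "('s, 'a) mdp \<Rightarrow> 's set \<Rightarrow> 's \<Rightarrow> real" where
  "max_reach M B s = (SUP \<pi>\<in>policies M. reach_prob M s B \<pi>)"

definition max_actions :: "('s::finite, 'a) mdp \<Rightarrow> 's set \<Rightarrow> 's \<Rightarrow> 'a set" where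
  "max_actions M B s = {a \<in> actions M s.
     max_reach M B s = (\<Sum>s'\<in>UNIV. pmf (transition M s a) s' * max_reach M B s')}"

definition cleaned_up :: "('s::finite, 'a) mdp \<Rightarrow> 's set \<Rightarrow> ('s, 'a) mdp" where
  "cleaned_up M B = M\<lparr>actions := max_actions M B\<rparr>"

section \<open>Perturbation of a decision rule\<close>

definition act :: "('s, 'a) mdp \<Rightarrow> ('s \<Rightarrow> 'a pmf) \<Rightarrow> 's \<Rightarrow> 'a set" where
  "act M d s = {a \<in> actions M s. pmf (d s) a > 0}"

definition pass :: "('s, 'a) mdp \<Rightarrow> ('s \<Rightarrow> 'a pmf) \<Rightarrow> 's \<Rightarrow> 'a set" where
  "pass M d s = actions M s - act M d s"

definition pass_act_ratio :: "('s, 'a) mdp \<Rightarrow> ('s \<Rightarrow> 'a pmf) \<Rightarrow> 's \<Rightarrow> real" where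
  "pass_act_ratio M d s = real (card (pass M d s)) / real (card (act M d s))"

definition perturbed_weight ::
  "('s, 'a) mdp \<Rightarrow> ('s \<Rightarrow> 'a pmf) \<Rightarrow> real \<Rightarrow> 's \<Rightarrow> 'a \<Rightarrow> real" where
  "perturbed_weight M d e s a =
     (if a \<in> pass M d s then e
      else if a \<in> act M d s then pmf (d s) a - e * pass_act_ratio M d s
      else 0)"

text \<open>
  \<open>embed_pmf\<close> gives the intended distribution only for nonnegative weights; see the lemma below.
\<close>

definition perturbed ::
  "('s, 'a) mdp \<Rightarrow> ('s \<Rightarrow> 'a pmf) \<Rightarrow> real \<Rightarrow> 's \<Rightarrow> 'a pmf" where
  "perturbed M d e s = embed_pmf (perturbed_weight M d e s)"

lemma pmf_perturbed:
  fixes M :: "('s, 'a::finite) mdp"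
  assumes "stationary d \<in> policies M" and nonneg: "\<And>a. 0 \<le> perturbed_weight M d e s a"
  shows "pmf (perturbed M d e s) a = perturbed_weight M d e s a"
proof -
  have supp: "set_pmf (d s) \<subseteq> actions M s"
    using assms(1) by (auto simp: policies_def)
  then have act: "act M d s = set_pmf (d s)"
    by (auto simp: act_def set_pmf_iff pmf_positive_iff)
  then have card: "card (act M d s) \<noteq> 0"
    by (simp add: set_pmf_not_empty)
  have disj: "pass M d s \<inter> act M d s = {}"
    by (auto simp: pass_def)
  have "(\<Sum>a\<in>UNIV. perturbed_weight M d e s a)
      = (\<Sum>a\<in>pass M d s \<union> act M d s. perturbed_weight M d e s a)"
    by (rule sum.mono_neutral_right) (auto simp: perturbed_weight_def)
  also have "\<dots> = (\<Sum>a\<in>pass M d s. e) + (\<Sum>a\<in>act M d s. pmf (d s) a - e * pass_act_ratio M d s)"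
    using disj by (subst sum.union_disjoint) (auto simp: perturbed_weight_def intro!: sum.cong)
  also have "(\<Sum>a\<in>act M d s. pmf (d s) a - e * pass_act_ratio M d s)
      = (\<Sum>a\<in>act M d s. pmf (d s) a) - e * card (pass M d s)"
    using card by (simp add: sum_subtractf pass_act_ratio_def)
  also have "(\<Sum>a\<in>act M d s. pmf (d s) a) = 1"
    unfolding act by (rule sum_pmf_eq_1) auto
  finally have "(\<Sum>a\<in>UNIV. perturbed_weight M d e s a) = 1"
    by simp
  then have "(\<integral>\<^sup>+a. ennreal (perturbed_weight M d e s a) \<partial>count_space UNIV) = 1"
    using nonneg by (simp add: nn_integral_count_space_finite sum_ennreal)
  then show ?thesis
    unfolding perturbed_def by (intro pmf_embed_pmf nonneg)
qed

section \<open>Matrices and vectors\<close>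

definition transition_matrix ::
  "('s::finite, 'a) mdp \<Rightarrow> ('s \<Rightarrow> 'a pmf) \<Rightarrow> real ^ 's ^ 's" where
  "transition_matrix M d =
     (\<chi> s s'. \<Sum>a\<in>actions M s. pmf (d s) a * pmf (transition M s a) s')"

definition cost_vector ::
  "('s::finite, 'a) mdp \<Rightarrow> ('s \<Rightarrow> 'a \<Rightarrow> real) \<Rightarrow> ('s \<Rightarrow> 'a pmf) \<Rightarrow> real ^ 's" where
  "cost_vector M c d = (\<chi> s. \<Sum>a\<in>actions M s. pmf (d s) a * c s a)"

definition initial_vector :: "('s::finite, 'a) mdp \<Rightarrow> real ^ 's" where
  "initial_vector M = axis (initial M) 1"

definition resolvent ::
  "('s::finite, 'a) mdp \<Rightarrow> real \<Rightarrow> ('s \<Rightarrow> 'a pmf) \<Rightarrow> real ^ 's ^ 's" where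
  "resolvent M \<beta> d = matrix_inv (mat 1 - \<beta> *\<^sub>R transition_matrix M d)"

definition perturbation_matrix ::
  "('s::finite, 'a) mdp \<Rightarrow> ('s \<Rightarrow> 'a pmf) \<Rightarrow> real ^ 's ^ 's" where
  "perturbation_matrix M d = (\<chi> s s'.
     (\<Sum>a\<in>pass M d s. pmf (transition M s a) s')
     - pass_act_ratio M d s * (\<Sum>a\<in>act M d s. pmf (transition M s a) s'))"

definition perturbation_vector ::
  "('s::finite, 'a) mdp \<Rightarrow> ('s \<Rightarrow> 'a \<Rightarrow> real) \<Rightarrow> ('s \<Rightarrow> 'a pmf) \<Rightarrow> real ^ 's" where
  "perturbation_vector M c d = (\<chi> s.
     (\<Sum>a\<in>pass M d s. c s a) - pass_act_ratio M d s * (\<Sum>a\<in>act M d s. c s a))"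

definition gamma1 :: "('s::finite, 'a) mdp \<Rightarrow> ('s \<Rightarrow> 'a \<Rightarrow> real) \<Rightarrow> real
    \<Rightarrow> ('s \<Rightarrow> 'a pmf) \<Rightarrow> real \<Rightarrow> real" where
  "gamma1 M c \<beta> d e = \<beta> * (initial_vector M \<bullet>
     ((resolvent M \<beta> d ** perturbation_matrix M d ** resolvent M \<beta> (perturbed M d e))
        *v cost_vector M c d))"

definition gamma2 :: "('s::finite, 'a) mdp \<Rightarrow> ('s \<Rightarrow> 'a \<Rightarrow> real) \<Rightarrow> real
    \<Rightarrow> ('s \<Rightarrow> 'a pmf) \<Rightarrow> real \<Rightarrow> real" where
  "gamma2 M c \<beta> d e = initial_vector M \<bullet>
     (resolvent M \<beta> (perturbed M d e) *v perturbation_vector M c d)"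

end

theory Submission
  imports Defs
begin

text \<open>
  Let \<open>x\<close> be the maximal reachability probability; value iteration shows that it satisfies the
  Bellman equation. Under any policy \<open>x\<close> is a supermartingale along the state process, and a
  policy optimal for reachability makes it a martingale, so such a policy uses only maximal actions
  in the states it visits and its cost is that of a policy of the cleaned-up process. Conversely,
  let \<open>h\<close> be the reachability probability of a policy charging exactly the maximal actions. If
  \<open>h \<noteq> x\<close>, the states where \<open>x - h\<close> attains its maximum form a set closed under all maximal
  actions and disjoint from the target, on which \<open>x\<close> is constant; every other action strictly loses
  value there, so value iteration stays bounded away from \<open>x\<close>, a contradiction. Hence the perturbed
  policy is optimal for reachability, and the resolvent identity shows that the perturbation changes
  the cost by exactly \<open>e * (gamma1 + gamma2)\<close>.
\<close>

section \<open>Marginals of the path measure\<close>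

text \<open>\<open>PF.lim\<close> is accessible only through its finite projections, and
  \<open>CI {0..<n}\<close> is in turn a projection of \<open>C 0 k\<close> for the least
  \<open>k\<close> covering the index set. Here \<open>k = n\<close>, so that projection loses
  nothing.\<close>

lemma (in Ionescu_Tulcea) nn_integral_lim_restrict:
  assumes f: "f \<in> borel_measurable (PiM {0..<n} M)"
  shows "(\<integral>\<^sup>+\<omega>. f (restrict \<omega> {0..<n}) \<partial>PF.lim) = (\<integral>\<^sup>+\<omega>. f \<omega> \<partial>C 0 n (\<lambda>_. undefined))"
proof -
  have up: "up_to {0..<n} \<le> n"
    by (simp add: up_to_iff)
  have up': "up_to {0..<n} = n"
  proof (rule antisym[OF up])
    show "n \<le> up_to {0..<n}"
      using up_to[of "{0..<n}"] by (cases n) (auto simp: subset_iff)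
  qed
  have m: "(\<lambda>\<omega>. restrict \<omega> {0..<n}) \<in> measurable PF.lim (PiM {0..<n} M)"
    by (subst measurable_cong_sets[OF PF.sets_lim refl]) (rule measurable_restrict_subset, simp)
  have m': "(\<lambda>\<omega>. restrict \<omega> {0..<n}) \<in> measurable (C 0 n (\<lambda>_. undefined)) (PiM {0..<n} M)"
    by (subst measurable_cong_sets[OF sets_C refl]) (auto intro!: measurable_restrict_subset)
  have "(\<integral>\<^sup>+\<omega>. f (restrict \<omega> {0..<n}) \<partial>PF.lim) = (\<integral>\<^sup>+\<omega>. f \<omega> \<partial>CI {0..<n})"
    using f m by (subst distr_lim[symmetric]) (auto simp: nn_integral_distr)
  also have "\<dots> = (\<integral>\<^sup>+\<omega>. f (restrict \<omega> {0..<n}) \<partial>C 0 n (\<lambda>_. undefined))"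
    unfolding CI_def up' using f m' by (simp add: nn_integral_distr)
  also have "\<dots> = (\<integral>\<^sup>+\<omega>. f \<omega> \<partial>C 0 n (\<lambda>_. undefined))"
    by (rule nn_integral_C[of n n f 0, simplified, symmetric]) (use f in auto)
  finally show ?thesis .
qed

text \<open>One-step disintegration: \<open>C 0 (Suc n)\<close> is by construction the bind of
  \<open>C 0 n\<close> with the kernel \<open>eP n\<close>, which appends a coordinate drawn from
  \<open>P n\<close>. The later marginal laws all come from this.\<close>

lemma (in Ionescu_Tulcea) nn_integral_lim_Suc:
  assumes f: "f \<in> borel_measurable (PiM {0..<Suc n} M)"
  shows "(\<integral>\<^sup>+\<omega>. f (restrict \<omega> {0..<Suc n}) \<partial>PF.lim) =
    (\<integral>\<^sup>+\<omega>. \<integral>\<^sup>+x. f ((restrict \<omega> {0..<n})(n := x)) \<partial>P n (restrict \<omega> {0..<n}) \<partial>PF.lim)"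
proof -
  have sp: "(\<lambda>_. undefined) \<in> space (PiM {0..<0} M)"
    by (simp add: space_PiM)
  have m: "(\<lambda>\<omega>. \<integral>\<^sup>+x. f x \<partial>eP n \<omega>) \<in> borel_measurable (PiM {0..<n} M)"
    by (rule nn_integral_measurable_subprob_algebra2[where N="PiM {0..<Suc n} M"])
       (use f in \<open>auto simp: measurable_split_conv\<close>)
  have eq: "(\<integral>\<^sup>+y. f y \<partial>eP n x) = (\<integral>\<^sup>+y. f (x(n := y)) \<partial>P n x)"
    if "x \<in> space (PiM {0..<n} M)" for x
    using that f by (rule nn_integral_eP)
  have "(\<integral>\<^sup>+\<omega>. f (restrict \<omega> {0..<Suc n}) \<partial>PF.lim) = (\<integral>\<^sup>+\<omega>. f \<omega> \<partial>C 0 (Suc n) (\<lambda>_. undefined))"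
    by (rule nn_integral_lim_restrict[OF f])
  also have "\<dots> = (\<integral>\<^sup>+\<omega>. \<integral>\<^sup>+x. f x \<partial>eP n \<omega> \<partial>C 0 n (\<lambda>_. undefined))"
    unfolding C.simps using f measurable_eP[of n]
    by (subst nn_integral_bind[where B="PiM {0..<Suc n} M"])
       (auto simp: measurable_cong_sets[OF sets_C[OF sp] refl])
  also have "\<dots> = (\<integral>\<^sup>+\<omega>. \<integral>\<^sup>+x. f x \<partial>eP n (restrict \<omega> {0..<n}) \<partial>PF.lim)"
    by (rule nn_integral_lim_restrict[OF m, symmetric])
  also have "\<dots> = (\<integral>\<^sup>+\<omega>. \<integral>\<^sup>+x. f ((restrict \<omega> {0..<n})(n := x)) \<partial>P n (restrict \<omega> {0..<n}) \<partial>PF.lim)"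
  proof (rule nn_integral_cong)
    fix \<omega> assume "\<omega> \<in> space PF.lim"
    then have "restrict \<omega> {0..<n} \<in> space (PiM {0..<n} M)"
      by (auto simp: PF.space_lim space_PiM)
    then show "(\<integral>\<^sup>+x. f x \<partial>eP n (restrict \<omega> {0..<n})) =
        (\<integral>\<^sup>+x. f ((restrict \<omega> {0..<n})(n := x)) \<partial>P n (restrict \<omega> {0..<n}))"
      by (rule eq)
  qed
  finally show ?thesis .
qed

section \<open>Laws of single states and of state-action pairs\<close>

text \<open>Under a Markovian policy the states alone form a time-inhomogeneous Markov chain; its
  marginals turn reachability and cost into expectations over finite types.\<close>

primrec state_law :: "('s, 'a) mdp \<Rightarrow> 's \<Rightarrow> ('s, 'a) policy \<Rightarrow> nat \<Rightarrow> 's pmf" where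
  "state_law M s \<pi> 0 = return_pmf s"
| "state_law M s \<pi> (Suc t) =
     bind_pmf (state_law M s \<pi> t) (\<lambda>s'. bind_pmf (\<pi> t s') (transition M s'))"

definition pair_law :: "('s, 'a) mdp \<Rightarrow> 's \<Rightarrow> ('s, 'a) policy \<Rightarrow> nat \<Rightarrow> ('s \<times> 'a) pmf" where
  "pair_law M s \<pi> t = bind_pmf (state_law M s \<pi> t) (\<lambda>s'. map_pmf (Pair s') (\<pi> t s'))"

text \<open>The kernel \<open>step\<close> at time \<open>Suc t\<close>, as a function of the only
  part of the history it reads, the pair at time \<open>t\<close>.\<close>

definition successor_law :: "('s, 'a) mdp \<Rightarrow> ('s, 'a) policy \<Rightarrow> nat \<Rightarrow> 's \<times> 'a \<Rightarrow> ('s \<times> 'a) pmf" where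
  "successor_law M \<pi> t x =
     bind_pmf (transition M (fst x) (snd x)) (\<lambda>s'. map_pmf (Pair s') (\<pi> (Suc t) s'))"

lemma pair_law_Suc: "pair_law M s \<pi> (Suc t) = bind_pmf (pair_law M s \<pi> t) (successor_law M \<pi> t)"
  by (simp add: pair_law_def successor_law_def bind_assoc_pmf bind_map_pmf)

lemma sets_path_measure [measurable_cong]:
  fixes M :: "('s::finite, 'a::finite) mdp"
  shows "sets (path_measure M s \<pi>) = sets (PiM UNIV (\<lambda>_. count_space UNIV))"
proof -
  interpret Ionescu_Tulcea "step M s \<pi>" "\<lambda>_. count_space UNIV"
    by (rule Ionescu_Tulcea_step)
  show ?thesis
    unfolding path_measure_def by (rule PF.sets_lim)
qed

lemma measurable_path_component [measurable]:
  fixes M :: "('s::finite, 'a::finite) mdp"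
  shows "(\<lambda>\<omega>. \<omega> n) \<in> measurable (path_measure M s \<pi>) (count_space UNIV)"
  by (subst measurable_cong_sets[OF sets_path_measure refl]) (rule measurable_component_singleton, simp)

lemma nn_integral_path_0:
  fixes M :: "('s::finite, 'a::finite) mdp"
  shows "(\<integral>\<^sup>+\<omega>. f (\<omega> 0) \<partial>path_measure M s \<pi>) = (\<integral>\<^sup>+x. f x \<partial>pair_law M s \<pi> 0)"
proof -
  interpret Ionescu_Tulcea "step M s \<pi>" "\<lambda>_. count_space UNIV"
    by (rule Ionescu_Tulcea_step)
  interpret path: prob_space "path_measure M s \<pi>"
    by (rule prob_space_path_measure)
  have "(\<lambda>\<omega>. f (\<omega> 0)) \<in> borel_measurable (PiM {0..<Suc 0} (\<lambda>_. count_space UNIV))"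
    by (rule measurable_compose[OF measurable_component_singleton]) auto
  from nn_integral_lim_Suc[OF this] show ?thesis
    using path.emeasure_space_1
    by (simp add: step_def pair_law_def bind_return_pmf path_measure_def[symmetric])
qed

text \<open>The two-argument \<open>f\<close> keeps the joint law of consecutive pairs, which
  absorption needs; an \<open>f\<close> ignoring its first argument yields the recursion for the
  marginals.\<close>

lemma nn_integral_path_Suc:
  fixes M :: "('s::finite, 'a::finite) mdp"
  shows "(\<integral>\<^sup>+\<omega>. f (\<omega> n) (\<omega> (Suc n)) \<partial>path_measure M s \<pi>) =
    (\<integral>\<^sup>+\<omega>. \<integral>\<^sup>+x. f (\<omega> n) x \<partial>successor_law M \<pi> n (\<omega> n) \<partial>path_measure M s \<pi>)"
proof -
  interpret Ionescu_Tulcea "step M s \<pi>" "\<lambda>_. count_space UNIV"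
    by (rule Ionescu_Tulcea_step)
  have m: "(\<lambda>\<omega>. \<omega> i) \<in> measurable (PiM {0..<Suc (Suc n)} (\<lambda>_. count_space UNIV)) (count_space UNIV)"
    if "i < Suc (Suc n)" for i
    by (rule measurable_component_singleton) (use that in simp)
  have "(\<lambda>\<omega>. f (\<omega> n) (\<omega> (Suc n))) \<in> borel_measurable
      (PiM {0..<Suc (Suc n)} (\<lambda>_. count_space UNIV :: ('s \<times> 'a) measure))"
    by (rule measurable_compose_countable'[where f="\<lambda>x \<omega>. f x (\<omega> (Suc n))" and g="\<lambda>\<omega>. \<omega> n" and I=UNIV])
       (auto intro!: m measurable_compose[OF m])
  from nn_integral_lim_Suc[OF this] show ?thesis
    by (simp add: step_def successor_law_def path_measure_def[symmetric] case_prod_beta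
        del: nn_integral_bind_pmf nn_integral_map_pmf)
qed

lemma nn_integral_path:
  fixes M :: "('s::finite, 'a::finite) mdp"
  shows "(\<integral>\<^sup>+\<omega>. f (\<omega> n) \<partial>path_measure M s \<pi>) = (\<integral>\<^sup>+x. f x \<partial>pair_law M s \<pi> n)"
proof (induction n arbitrary: f)
  case 0
  show ?case by (rule nn_integral_path_0)
next
  case (Suc n)
  show ?case
    unfolding nn_integral_path_Suc[where f="\<lambda>_. f"]
      Suc[of "\<lambda>x. \<integral>\<^sup>+y. f y \<partial>successor_law M \<pi> n x"]
    by (simp add: pair_law_Suc)
qed

lemma distr_path:
  fixes M :: "('s::finite, 'a::finite) mdp"
  shows "distr (path_measure M s \<pi>) (count_space UNIV) (\<lambda>\<omega>. \<omega> n) = measure_pmf (pair_law M s \<pi> n)"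
proof (rule measure_eqI)
  fix A :: "('s \<times> 'a) set"
  have "emeasure (distr (path_measure M s \<pi>) (count_space UNIV) (\<lambda>\<omega>. \<omega> n)) A =
      (\<integral>\<^sup>+x. indicator A x \<partial>distr (path_measure M s \<pi>) (count_space UNIV) (\<lambda>\<omega>. \<omega> n))"
    by simp
  also have "\<dots> = (\<integral>\<^sup>+\<omega>. indicator A (\<omega> n) \<partial>path_measure M s \<pi>)"
    by (rule nn_integral_distr) auto
  also have "\<dots> = emeasure (measure_pmf (pair_law M s \<pi> n)) A"
    by (simp add: nn_integral_path)
  finally show "emeasure (distr (path_measure M s \<pi>) (count_space UNIV) (\<lambda>\<omega>. \<omega> n)) A =
      emeasure (measure_pmf (pair_law M s \<pi> n)) A" .
qed simp

lemma integral_path: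
  fixes M :: "('s::finite, 'a::finite) mdp" and f :: "'s \<times> 'a \<Rightarrow> real"
  shows "(\<integral>\<omega>. f (\<omega> n) \<partial>path_measure M s \<pi>) = (\<integral>x. f x \<partial>pair_law M s \<pi> n)"
  unfolding distr_path[symmetric] by (rule integral_distr[symmetric]) auto

lemma set_pair_law: "set_pmf (pair_law M s \<pi> t) = (SIGMA s':set_pmf (state_law M s \<pi> t). set_pmf (\<pi> t s'))"
  by (auto simp: pair_law_def)

section \<open>Reachability\<close>

lemma expectation_finite:
  fixes p :: "'b::finite pmf" and f :: "'b \<Rightarrow> real"
  shows "measure_pmf.expectation p f = (\<Sum>x\<in>UNIV. pmf p x * f x)"
  by (subst integral_measure_pmf[of UNIV]) auto

lemma expectation_bind:
  fixes p :: "'b::finite pmf" and q :: "'b \<Rightarrow> 'c::finite pmf" and f :: "'c \<Rightarrow> real"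
  shows "measure_pmf.expectation (bind_pmf p q) f =
    measure_pmf.expectation p (\<lambda>x. measure_pmf.expectation (q x) f)"
  by (subst pmf_expectation_bind[of UNIV]) (auto simp: expectation_finite)

lemma expectation_mono:
  fixes p :: "'b::finite pmf" and f g :: "'b \<Rightarrow> real"
  assumes "\<And>x. x \<in> set_pmf p \<Longrightarrow> f x \<le> g x"
  shows "measure_pmf.expectation p f \<le> measure_pmf.expectation p g"
  unfolding expectation_finite
proof (rule sum_mono)
  show "pmf p x * f x \<le> pmf p x * g x" for x
    using assms[of x] by (cases "x \<in> set_pmf p") (auto simp: set_pmf_iff intro: mult_left_mono)
qed

lemma expectation_cong:
  fixes p :: "'b::finite pmf" and f g :: "'b \<Rightarrow> real"
  assumes "\<And>x. x \<in> set_pmf p \<Longrightarrow> f x = g x"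
  shows "measure_pmf.expectation p f = measure_pmf.expectation p g"
  by (rule antisym; rule expectation_mono) (simp_all add: assms)

text \<open>The terms \<open>pmf p y * (g y - f y)\<close> are nonnegative and sum to
  \<open>0\<close>, so each vanishes. This equality case drives both the maximum principle and the
  analysis of optimal policies.\<close>

lemma expectation_eq_imp_eq_on_support:
  fixes p :: "'b::finite pmf" and f g :: "'b \<Rightarrow> real"
  assumes le: "\<And>x. x \<in> set_pmf p \<Longrightarrow> f x \<le> g x"
    and eq: "measure_pmf.expectation p f = measure_pmf.expectation p g"
    and x: "x \<in> set_pmf p"
  shows "f x = g x"
proof -
  have nonneg: "0 \<le> pmf p y * (g y - f y)" for y
    using le[of y] by (cases "y \<in> set_pmf p") (auto simp: set_pmf_iff)
  have "(\<Sum>y\<in>UNIV. pmf p y * (g y - f y)) = 0"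
    using eq by (simp add: expectation_finite right_diff_distrib sum_subtractf)
  then have "pmf p x * (g x - f x) = 0"
    using nonneg by (subst (asm) sum_nonneg_eq_0_iff) auto
  then show ?thesis
    using x by (simp add: set_pmf_iff)
qed

lemma tendsto_expectation:
  fixes p :: "'b::finite pmf" and f :: "nat \<Rightarrow> 'b \<Rightarrow> real"
  assumes "\<And>x. (\<lambda>n. f n x) \<longlonglongrightarrow> g x"
  shows "(\<lambda>n. measure_pmf.expectation p (f n)) \<longlonglongrightarrow> measure_pmf.expectation p g"
  unfolding expectation_finite by (intro tendsto_intros assms)

lemma expectation_diff:
  fixes p :: "'b::finite pmf" and f g :: "'b \<Rightarrow> real"
  shows "measure_pmf.expectation p (\<lambda>x. f x - g x) =
    measure_pmf.expectation p f - measure_pmf.expectation p g"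
  by (simp add: expectation_finite right_diff_distrib sum_subtractf)

text \<open>The transition operator of a decision rule acting backwards on functions of the state,
  dual to the forward recursion of \<open>state_law\<close>.\<close>

definition policy_step :: "('s, 'a) mdp \<Rightarrow> ('s \<Rightarrow> 'a pmf) \<Rightarrow> ('s \<Rightarrow> real) \<Rightarrow> 's \<Rightarrow> real" where
  "policy_step M d f s =
     measure_pmf.expectation (d s) (\<lambda>a. measure_pmf.expectation (transition M s a) f)"

lemma expectation_state_law_Suc:
  fixes M :: "('s::finite, 'a::finite) mdp"
  shows "measure_pmf.expectation (state_law M s \<pi> (Suc t)) f =
    measure_pmf.expectation (state_law M s \<pi> t) (policy_step M (\<pi> t) f)"
  by (simp add: expectation_bind policy_step_def[abs_def])

lemma expectation_state_law_stationary:
  fixes M :: "('s::finite, 'a::finite) mdp"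
  shows "measure_pmf.expectation (state_law M s (stationary d) t) f = (policy_step M d ^^ t) f s"
proof (induction t arbitrary: f)
  case (Suc t)
  show ?case
    unfolding expectation_state_law_Suc Suc by (simp add: funpow_swap1)
qed simp

lemma prob_state_in:
  fixes M :: "('s::finite, 'a::finite) mdp"
  shows "\<P>(\<omega> in path_measure M s \<pi>. fst (\<omega> n) \<in> A) =
    measure_pmf.expectation (state_law M s \<pi> n) (indicator A)"
proof -
  interpret path: prob_space "path_measure M s \<pi>"
    by (rule prob_space_path_measure)
  have "\<P>(\<omega> in path_measure M s \<pi>. fst (\<omega> n) \<in> A) =
      (\<integral>\<omega>. indicator {\<omega> \<in> space (path_measure M s \<pi>). fst (\<omega> n) \<in> A} \<omega> \<partial>path_measure M s \<pi>)"
    by simp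
  also have "\<dots> = (\<integral>\<omega>. indicator A (fst (\<omega> n)) \<partial>path_measure M s \<pi>)"
    by (rule Bochner_Integration.integral_cong) (auto simp: indicator_def)
  also have "\<dots> = measure_pmf.expectation (pair_law M s \<pi> n) (\<lambda>x. indicator A (fst x))"
    by (rule integral_path[where f="\<lambda>x. indicator A (fst x)"])
  also have "\<dots> = measure_pmf.expectation (state_law M s \<pi> n) (indicator A)"
    by (simp add: pair_law_def expectation_bind)
  finally show ?thesis .
qed

lemma prob_state_in_le_reach_prob:
  fixes M :: "('s::finite, 'a::finite) mdp"
  shows "measure_pmf.expectation (state_law M s \<pi> n) (indicator B) \<le> reach_prob M s B \<pi>"
proof -
  interpret path: prob_space "path_measure M s \<pi>"
    by (rule prob_space_path_measure)
  show ?thesis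
    unfolding prob_state_in[symmetric] reach_prob_def
    by (rule path.finite_measure_mono) auto
qed

lemma reach_prob_le_1:
  fixes M :: "('s::finite, 'a::finite) mdp"
  shows "reach_prob M s B \<pi> \<le> 1"
proof -
  interpret path: prob_space "path_measure M s \<pi>"
    by (rule prob_space_path_measure)
  show ?thesis
    unfolding reach_prob_def by (rule path.prob_le_1)
qed

section \<open>Absorption and limits of reachability probabilities\<close>

locale absorbing_target =
  fixes M :: "('s::finite, 'a::finite) mdp" and B :: "'s set"
  assumes absorbing: "\<And>s. s \<in> B \<Longrightarrow> absorbing M s"
    and actions_nonempty: "\<And>s. actions M s \<noteq> {}"
begin

lemma transition_absorbing:
  assumes "s \<in> B" "a \<in> actions M s"
  shows "transition M s a = return_pmf s"
proof -
  have "pmf (transition M s a) s = 1"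
    using assms absorbing by (auto simp: absorbing_def)
  then have "measure_pmf.prob (transition M s a) {s} = 1"
    by (simp add: measure_pmf_single)
  then have "set_pmf (transition M s a) \<subseteq> {s}"
    by (simp add: measure_pmf.prob_eq_1 AE_measure_pmf_iff subset_iff)
  then show ?thesis
    by (simp add: set_pmf_subset_singleton)
qed

text \<open>A policy chooses available actions, so from a target state the next state is
  deterministic and the expected indicator of leaving \<open>B\<close> at step \<open>n\<close> is
  \<open>0\<close>. There are only countably many steps.\<close>

lemma AE_absorbed:
  assumes \<pi>: "\<pi> \<in> policies M"
  shows "AE \<omega> in path_measure M s \<pi>. \<forall>n. fst (\<omega> n) \<in> B \<longrightarrow> fst (\<omega> (Suc n)) \<in> B"
proof (rule AE_all_countable[THEN iffD2], rule allI)
  fix n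
  define f :: "'s \<times> 'a \<Rightarrow> 's \<times> 'a \<Rightarrow> ennreal"
    where "f x y = (if fst x \<in> B \<and> fst y \<notin> B then 1 else 0)" for x y
  have "(\<integral>\<^sup>+y. f x y \<partial>successor_law M \<pi> n x) = 0" if "x \<in> set_pmf (pair_law M s \<pi> n)" for x
  proof (cases "fst x \<in> B")
    case True
    have "snd x \<in> actions M (fst x)"
      using that \<pi> by (fastforce simp: set_pair_law policies_def)
    with True have "transition M (fst x) (snd x) = return_pmf (fst x)"
      by (rule transition_absorbing)
    then show ?thesis
      using True by (simp add: successor_law_def f_def bind_return_pmf)
  qed (simp add: f_def)
  then have "(\<integral>\<^sup>+x. \<integral>\<^sup>+y. f x y \<partial>successor_law M \<pi> n x \<partial>pair_law M s \<pi> n) = 0"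
    by (subst nn_integral_0_iff_AE) (simp_all add: AE_measure_pmf_iff)
  then have "(\<integral>\<^sup>+\<omega>. f (\<omega> n) (\<omega> (Suc n)) \<partial>path_measure M s \<pi>) = 0"
    by (simp only: nn_integral_path_Suc
        nn_integral_path[where f="\<lambda>x. \<integral>\<^sup>+y. f x y \<partial>successor_law M \<pi> n x"])
  moreover have "(\<lambda>\<omega>. f (\<omega> n) (\<omega> (Suc n))) \<in> borel_measurable (path_measure M s \<pi>)"
    by (rule measurable_compose_countable'[where f="\<lambda>x \<omega>. f x (\<omega> (Suc n))" and g="\<lambda>\<omega>. \<omega> n" and I=UNIV])
       (auto intro!: measurable_compose[OF measurable_path_component])
  ultimately have "AE \<omega> in path_measure M s \<pi>. f (\<omega> n) (\<omega> (Suc n)) = 0"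
    by (simp add: nn_integral_0_iff_AE)
  then show "AE \<omega> in path_measure M s \<pi>. fst (\<omega> n) \<in> B \<longrightarrow> fst (\<omega> (Suc n)) \<in> B"
    by eventually_elim (auto simp: f_def split: if_splits)
qed

text \<open>Reaching \<open>B\<close> is the increasing union of the events of hitting
  \<open>B\<close> by time \<open>n\<close>. By absorption each agrees almost surely with being in
  \<open>B\<close> at time \<open>n\<close>, so the marginals suffice.\<close>

lemma reach_prob_tendsto:
  assumes \<pi>: "\<pi> \<in> policies M"
  shows "(\<lambda>n. measure_pmf.expectation (state_law M s \<pi> n) (indicator B)) \<longlonglongrightarrow> reach_prob M s B \<pi>"
proof -
  interpret path: prob_space "path_measure M s \<pi>"
    by (rule prob_space_path_measure)
  let ?A = "\<lambda>n. {\<omega> \<in> space (path_measure M s \<pi>). \<exists>i\<le>n. fst (\<omega> i) \<in> B}"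
  have meas: "?A n \<in> path.events" for n
    by measurable
  have "(\<lambda>n. path.prob (?A n)) \<longlonglongrightarrow> path.prob (\<Union>n. ?A n)"
    using meas by (intro path.finite_Lim_measure_incseq) (auto simp: incseq_def intro: order_trans)
  also have "(\<Union>n. ?A n) = {\<omega> \<in> space (path_measure M s \<pi>). \<exists>t. fst (\<omega> t) \<in> B}"
    by auto
  also have "(\<lambda>n. path.prob (?A n)) = (\<lambda>n. measure_pmf.expectation (state_law M s \<pi> n) (indicator B))"
  proof
    fix n
    have "path.prob (?A n) = \<P>(\<omega> in path_measure M s \<pi>. fst (\<omega> n) \<in> B)"
    proof (rule path.finite_measure_eq_AE)
      show "AE \<omega> in path_measure M s \<pi>. (\<omega> \<in> ?A n) =
          (\<omega> \<in> {\<omega> \<in> space (path_measure M s \<pi>). fst (\<omega> n) \<in> B})"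
        using AE_absorbed[OF \<pi>]
      proof eventually_elim
        case (elim \<omega>)
        have "fst (\<omega> n) \<in> B" if "i \<le> n" "fst (\<omega> i) \<in> B" for i
          using that by (induction rule: dec_induct) (use elim in auto)
        then show ?case by auto
      qed
    qed (use meas in \<open>measurable\<close>)
    then show "path.prob (?A n) = measure_pmf.expectation (state_law M s \<pi> n) (indicator B)"
      by (simp add: prob_state_in)
  qed
  finally show ?thesis
    by (simp add: reach_prob_def)
qed

subsection \<open>Value iteration\<close>

text \<open>The optimal probability of being in \<open>B\<close> after \<open>n\<close> steps,
  computed by the Bellman operator.\<close>

primrec reach_value :: "nat \<Rightarrow> 's \<Rightarrow> real" where
  "reach_value 0 s = indicator B s"
| "reach_value (Suc n) s =
     Max ((\<lambda>a. measure_pmf.expectation (transition M s a) (reach_value n)) ` actions M s)"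

lemma transition_le_reach_value:
  "a \<in> actions M s \<Longrightarrow> measure_pmf.expectation (transition M s a) (reach_value n) \<le> reach_value (Suc n) s"
  by (auto intro!: Max_ge)

lemma reach_value_le:
  assumes "\<And>a. a \<in> actions M s \<Longrightarrow> measure_pmf.expectation (transition M s a) (reach_value n) \<le> q"
  shows "reach_value (Suc n) s \<le> q"
  using assms actions_nonempty by (auto intro!: Max.boundedI)

text \<open>Absorption gives the base case, as a state of \<open>B\<close> keeps the value
  \<open>1\<close>; monotonicity of the Bellman operator propagates the inequality.\<close>

lemma incseq_reach_value: "incseq (\<lambda>n. reach_value n s)"
proof (rule incseq_SucI)
  show "reach_value n s \<le> reach_value (Suc n) s" for n
  proof (induction n arbitrary: s)
    case 0
    obtain a where a: "a \<in> actions M s"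
      using actions_nonempty by auto
    have "reach_value 0 s \<le> measure_pmf.expectation (transition M s a) (reach_value 0)"
    proof (cases "s \<in> B")
      case True
      then show ?thesis by (simp add: transition_absorbing[OF _ a])
    next
      case False
      then show ?thesis by (simp add: integral_nonneg_AE)
    qed
    also have "\<dots> \<le> reach_value (Suc 0) s"
      by (rule transition_le_reach_value[OF a])
    finally show ?case .
  next
    case (Suc n)
    show ?case
    proof (rule reach_value_le)
      fix a assume a: "a \<in> actions M s"
      have "measure_pmf.expectation (transition M s a) (reach_value n) \<le>
          measure_pmf.expectation (transition M s a) (reach_value (Suc n))"
        by (rule expectation_mono) (rule Suc)
      also have "\<dots> \<le> reach_value (Suc (Suc n)) s"
        by (rule transition_le_reach_value[OF a])
      finally show "measure_pmf.expectation (transition M s a) (reach_value n) \<le>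
          reach_value (Suc (Suc n)) s" .
    qed
  qed
qed

text \<open>The last step of the law is traded for one more Bellman step of the value, hence the
  induction with \<open>k\<close> arbitrary.\<close>

lemma expectation_reach_value_le:
  assumes "\<pi> \<in> policies M"
  shows "measure_pmf.expectation (state_law M s \<pi> t) (reach_value k) \<le> reach_value (k + t) s"
proof (induction t arbitrary: k)
  case (Suc t)
  have "policy_step M (\<pi> t) (reach_value k) s' \<le> reach_value (Suc k) s'" for s'
  proof -
    have "policy_step M (\<pi> t) (reach_value k) s' \<le> measure_pmf.expectation (\<pi> t s') (\<lambda>_. reach_value (Suc k) s')"
      unfolding policy_step_def
      by (rule expectation_mono, rule transition_le_reach_value) (use assms in \<open>auto simp: policies_def\<close>)
    then show ?thesis by simp
  qed
  then have "measure_pmf.expectation (state_law M s \<pi> (Suc t)) (reach_value k) \<le>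
      measure_pmf.expectation (state_law M s \<pi> t) (reach_value (Suc k))"
    unfolding expectation_state_law_Suc by (intro expectation_mono)
  also have "\<dots> \<le> reach_value (Suc k + t) s"
    by (rule Suc)
  finally show ?case by simp
qed simp

lemma reach_value_attained:
  "\<exists>\<pi>\<in>policies M. measure_pmf.expectation (state_law M s \<pi> n) (indicator B) = reach_value n s"
proof -
  have ex: "\<exists>a. a \<in> actions M s' \<and>
      measure_pmf.expectation (transition M s' a) (reach_value k) = reach_value (Suc k) s'" for k s'
  proof -
    have "reach_value (Suc k) s' \<in>
        (\<lambda>a. measure_pmf.expectation (transition M s' a) (reach_value k)) ` actions M s'"
      unfolding reach_value.simps using actions_nonempty by (intro Max_in) auto
    then show ?thesis by (auto simp del: reach_value.simps)
  qed
  define g where "g k s' = (SOME a. a \<in> actions M s' \<and>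
      measure_pmf.expectation (transition M s' a) (reach_value k) = reach_value (Suc k) s')" for k s'
  have g: "g k s' \<in> actions M s'"
    "measure_pmf.expectation (transition M s' (g k s')) (reach_value k) = reach_value (Suc k) s'" for k s'
    unfolding g_def using someI_ex[OF ex[of s' k]] by blast+
  \<comment> \<open>At time \<open>t\<close> the rule is greedy for the \<open>n - Suc t\<close>
    steps that remain afterwards. From time \<open>n\<close> on the truncated subtraction gives
    \<open>g 0\<close>, still an available action.\<close>
  define \<pi> where "\<pi> t s' = return_pmf (g (n - Suc t) s')" for t s'
  \<comment> \<open>The expected value still to be collected is invariant along the greedy policy;
    \<open>t = n\<close> turns it into the probability of being in \<open>B\<close>.\<close>
  have "measure_pmf.expectation (state_law M s \<pi> t) (reach_value (n - t)) = reach_value n s" if "t \<le> n" for t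
    using that
  proof (induction t)
    case (Suc t)
    have "policy_step M (\<pi> t) (reach_value (n - Suc t)) = reach_value (n - t)"
      using g(2)[of _ "n - Suc t"] Suc.prems
      by (simp add: policy_step_def \<pi>_def fun_eq_iff Suc_diff_Suc del: reach_value.simps)
    then show ?case
      using Suc by (simp only: expectation_state_law_Suc)
  qed simp
  from this[of n] have "measure_pmf.expectation (state_law M s \<pi> n) (indicator B) = reach_value n s"
    by (simp add: reach_value.simps(1)[abs_def])
  moreover have "\<pi> \<in> policies M"
    using g(1) by (simp add: policies_def \<pi>_def)
  ultimately show ?thesis by blast
qed

lemma reach_prob_le_max_reach: "\<pi> \<in> policies M \<Longrightarrow> reach_prob M s B \<pi> \<le> max_reach M B s"
  unfolding max_reach_def by (rule cSUP_upper) (auto intro!: bdd_aboveI2 reach_prob_le_1)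

lemma policies_nonempty: "policies M \<noteq> {}"
  using reach_value_attained[of undefined 0] by auto

lemma max_reach_le_1: "max_reach M B s \<le> 1"
  unfolding max_reach_def by (rule cSUP_least) (auto simp: policies_nonempty reach_prob_le_1)

lemma reach_value_le_max_reach: "reach_value n s \<le> max_reach M B s"
  using reach_value_attained[of s n] prob_state_in_le_reach_prob[of M s _ n B] reach_prob_le_max_reach[of _ s]
  by (metis order_trans)

text \<open>Each finite-horizon value is attained by a policy, so the limit is at most the supremum;
  conversely these values dominate the \<open>n\<close>-step probabilities of every policy, hence
  their limits.\<close>

lemma reach_value_tendsto: "(\<lambda>n. reach_value n s) \<longlonglongrightarrow> max_reach M B s"
proof -
  obtain L where L: "(\<lambda>n. reach_value n s) \<longlonglongrightarrow> L" "\<And>n. reach_value n s \<le> L"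
    using incseq_convergent[OF incseq_reach_value] reach_value_le_max_reach by metis
  have "L \<le> max_reach M B s"
    by (rule LIMSEQ_le_const2[OF L(1)]) (auto simp: reach_value_le_max_reach)
  moreover have "max_reach M B s \<le> L"
    unfolding max_reach_def
  proof (rule cSUP_least[OF policies_nonempty])
    fix \<pi> assume \<pi>: "\<pi> \<in> policies M"
    have "measure_pmf.expectation (state_law M s \<pi> n) (indicator B) \<le> L" for n
      using expectation_reach_value_le[OF \<pi>, of s n 0] L(2)[of n]
      by (simp add: reach_value.simps(1)[abs_def])
    then show "reach_prob M s B \<pi> \<le> L"
      by (intro LIMSEQ_le_const2[OF reach_prob_tendsto[OF \<pi>]]) auto
  qed
  ultimately show ?thesis
    using L(1) by simp
qed

text \<open>The limit of the one-step Bellman inequality for value iteration;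
  \<open>max_actions\<close> collects the actions with equality.\<close>

lemma max_reach_superharmonic:
  assumes "a \<in> actions M s"
  shows "measure_pmf.expectation (transition M s a) (max_reach M B) \<le> max_reach M B s"
proof (rule LIMSEQ_le_const2)
  show "(\<lambda>n. measure_pmf.expectation (transition M s a) (reach_value n))
      \<longlonglongrightarrow> measure_pmf.expectation (transition M s a) (max_reach M B)"
    by (rule tendsto_expectation) (rule reach_value_tendsto)
  show "\<exists>N. \<forall>n\<ge>N. measure_pmf.expectation (transition M s a) (reach_value n) \<le> max_reach M B s"
    using transition_le_reach_value[OF assms] reach_value_le_max_reach order_trans by meson
qed

lemma max_actions_iff:
  "a \<in> max_actions M B s \<longleftrightarrow> a \<in> actions M s \<and>
    measure_pmf.expectation (transition M s a) (max_reach M B) = max_reach M B s"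
  by (auto simp: max_actions_def expectation_finite)

subsection \<open>Policies optimal for reachability\<close>

text \<open>The support must be all of the maximal actions: a rule using only some of them may
  preserve the value at every step and yet circle outside \<open>B\<close> forever.\<close>

lemma reach_prob_max_actions:
  assumes d: "\<And>s. set_pmf (d s) = max_actions M B s"
  shows "reach_prob M s B (stationary d) = max_reach M B s"
proof (rule ccontr)
  let ?x = "max_reach M B" and ?h = "\<lambda>s. reach_prob M s B (stationary d)"
  let ?P = "policy_step M d"
  define D where "D s = ?x s - ?h s" for s
  define m where "m = Max (range D)"
  define Z where "Z = {s. D s = m}"
  assume neq: "?h s \<noteq> ?x s"
  have pol: "stationary d \<in> policies M"
    using d by (auto simp: policies_def max_actions_def)
  have h_lim: "(\<lambda>n. (?P ^^ n) (indicator B) s) \<longlonglongrightarrow> ?h s" for s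
    using reach_prob_tendsto[OF pol, of s] by (simp only: expectation_state_law_stationary)
  have h_step: "?h s = ?P ?h s" for s
  proof (rule LIMSEQ_unique[OF LIMSEQ_Suc[OF h_lim]])
    show "(\<lambda>n. (?P ^^ Suc n) (indicator B) s) \<longlonglongrightarrow> ?P ?h s"
      unfolding funpow.simps o_apply policy_step_def[of M d _ s]
      by (intro tendsto_expectation h_lim)
  qed
  have x_step: "?x s = ?P ?x s" for s
  proof -
    have "?P ?x s = measure_pmf.expectation (d s) (\<lambda>_. ?x s)"
      unfolding policy_step_def by (rule expectation_cong) (auto simp: d max_actions_iff)
    then show ?thesis by simp
  qed
  \<comment> \<open>Both \<open>?x\<close> and \<open>?h\<close> are fixed points of
    \<open>?P\<close>, hence so is the gap \<open>D\<close>, to which the maximum principle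
    applies.\<close>
  have D_step: "D s = ?P D s" for s
    using h_step[of s] x_step[of s] by (simp add: D_def[abs_def] policy_step_def expectation_diff)
  have D_le: "D s \<le> m" for s
    unfolding m_def by (rule Max_ge) auto
  have "0 < D s"
    using neq reach_prob_le_max_reach[OF pol, of s] by (simp add: D_def)
  with D_le[of s] have m_pos: "0 < m" by simp
  have "m \<in> range D"
    unfolding m_def by (rule Max_in) auto
  then obtain z where z: "z \<in> Z"
    by (auto simp: Z_def)
  \<comment> \<open>Maximum principle: an average of values at most \<open>m\<close> equals
    \<open>m\<close>, first over actions and then over successors. Every maximal action is covered
    because it lies in the support of \<open>d s\<close>.\<close>
  have closed: "s' \<in> Z"
    if s: "s \<in> Z" and a: "a \<in> max_actions M B s" and s': "s' \<in> set_pmf (transition M s a)" for s a s'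
  proof -
    have le: "measure_pmf.expectation (transition M s a) D \<le> m" for a
      using expectation_mono[of "transition M s a" D "\<lambda>_. m"] D_le by simp
    have "measure_pmf.expectation (d s) (\<lambda>a. measure_pmf.expectation (transition M s a) D) =
        measure_pmf.expectation (d s) (\<lambda>_. m)"
      using D_step[of s] s by (simp add: policy_step_def Z_def)
    then have "measure_pmf.expectation (transition M s a) D = m"
      using le a by (intro expectation_eq_imp_eq_on_support[where f="\<lambda>a. measure_pmf.expectation (transition M s a) D"
          and g="\<lambda>_. m" and p="d s"]) (auto simp: d)
    then have "D s' = m"
      using D_le s' by (intro expectation_eq_imp_eq_on_support[where g="\<lambda>_. m" and p="transition M s a"]) auto
    then show ?thesis by (simp add: Z_def)
  qed
  have Z_B: "s \<notin> B" if "s \<in> Z" for s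
  proof
    assume "s \<in> B"
    then have "1 \<le> ?h s"
      using prob_state_in_le_reach_prob[of M s "stationary d" 0 B] by simp
    then have "D s \<le> 0"
      using max_reach_le_1[of s] by (simp add: D_def)
    then show False
      using that m_pos by (simp add: Z_def)
  qed
  \<comment> \<open>Started in \<open>Z\<close>, the chain of \<open>d\<close> stays there and never
    meets \<open>B\<close>; thus \<open>?h\<close> vanishes on \<open>Z\<close> and
    \<open>?x\<close> equals \<open>m\<close> there.\<close>
  have H0: "(?P ^^ n) (indicator B) s = 0" if "s \<in> Z" for n s
    using that
  proof (induction n arbitrary: s)
    case (Suc n)
    have "measure_pmf.expectation (transition M s a) ((?P ^^ n) (indicator B)) = 0"
      if "a \<in> set_pmf (d s)" for a
    proof -
      have "measure_pmf.expectation (transition M s a) ((?P ^^ n) (indicator B)) =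
          measure_pmf.expectation (transition M s a) (\<lambda>_. 0)"
        by (rule expectation_cong) (use Suc.IH closed[OF Suc.prems] that d in auto)
      then show ?thesis by simp
    qed
    then have "?P ((?P ^^ n) (indicator B)) s = measure_pmf.expectation (d s) (\<lambda>_. 0)"
      unfolding policy_step_def[of M d "(?P ^^ n) (indicator B)" s] by (rule expectation_cong)
    then show ?case by simp
  qed (use Z_B in auto)
  have x_Z: "?x s = m" if "s \<in> Z" for s
  proof -
    have "?h s = 0"
      using h_lim[of s] by (simp add: H0[OF that] LIMSEQ_const_iff)
    then show ?thesis
      using that by (simp add: Z_def D_def)
  qed
  \<comment> \<open>On \<open>Z\<close> maximal actions stay inside \<open>Z\<close>, where \<open>B\<close> is never hit, and any other action
    loses value, so the finite-horizon values stay below some \<open>q < m\<close> there.\<close>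
  define Q where "Q = insert 0 ((\<lambda>(s, a). measure_pmf.expectation (transition M s a) ?x) `
      {(s, a). s \<in> Z \<and> a \<in> actions M s - max_actions M B s})"
  define q where "q = Max Q"
  have fin: "finite Q"
    by (simp add: Q_def)
  have "v < m" if "v \<in> Q" for v
    using that m_pos max_reach_superharmonic x_Z
    by (force simp: Q_def max_actions_iff less_le)
  then have q: "q < m"
    using fin by (simp add: q_def Q_def)
  have q_ge: "v \<le> q" if "v \<in> Q" for v
    using that fin by (simp add: q_def)
  \<comment> \<open>The element \<open>0\<close> of \<open>Q\<close> serves the base case. A maximal
    action leads back into \<open>Z\<close>, where the induction hypothesis holds; for any other
    action \<open>?x\<close> bounds the value and \<open>Q\<close> contains the resulting
    expectation.\<close>
  have "reach_value n s \<le> q" if "s \<in> Z" for n s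
    using that
  proof (induction n arbitrary: s)
    case 0
    then show ?case using q_ge[of 0] Z_B by (simp add: Q_def)
  next
    case (Suc n)
    show ?case
    proof (rule reach_value_le)
      fix a assume a: "a \<in> actions M s"
      show "measure_pmf.expectation (transition M s a) (reach_value n) \<le> q"
      proof (cases "a \<in> max_actions M B s")
        case True
        have "measure_pmf.expectation (transition M s a) (reach_value n) \<le>
            measure_pmf.expectation (transition M s a) (\<lambda>_. q)"
          by (rule expectation_mono) (use Suc closed True in auto)
        then show ?thesis by simp
      next
        case False
        have "measure_pmf.expectation (transition M s a) (reach_value n) \<le>
            measure_pmf.expectation (transition M s a) ?x"
          by (rule expectation_mono) (rule reach_value_le_max_reach)
        also have "\<dots> \<le> q"
          using False a Suc.prems by (intro q_ge) (force simp: Q_def)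
        finally show ?thesis .
      qed
    qed
  qed
  then have "?x z \<le> q"
    using z by (intro LIMSEQ_le_const2[OF reach_value_tendsto]) auto
  with q x_Z[OF z] show False by simp
qed

text \<open>The expectation of \<open>max_reach\<close> along the state process never increases.
  Optimality keeps it at its initial value, which forces equality in every visited state and for
  every action chosen there.\<close>

lemma reach_optimal_max_actions:
  assumes \<pi>: "\<pi> \<in> policies M" and opt: "reach_prob M s B \<pi> = max_reach M B s"
    and s': "s' \<in> set_pmf (state_law M s \<pi> t)"
  shows "set_pmf (\<pi> t s') \<subseteq> max_actions M B s'"
proof -
  let ?x = "max_reach M B" and ?e = "\<lambda>t. measure_pmf.expectation (state_law M s \<pi> t) (max_reach M B)"
  have act: "a \<in> actions M s'" if "a \<in> set_pmf (\<pi> t s')" for t a s'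
    using that \<pi> by (auto simp: policies_def)
  have step: "policy_step M (\<pi> t) ?x s' \<le> ?x s'" for t s'
  proof -
    have "policy_step M (\<pi> t) ?x s' \<le> measure_pmf.expectation (\<pi> t s') (\<lambda>_. ?x s')"
      unfolding policy_step_def by (intro expectation_mono max_reach_superharmonic act)
    then show ?thesis by simp
  qed
  have "decseq ?e"
    by (rule decseq_SucI, subst expectation_state_law_Suc, rule expectation_mono, rule step)
  have e: "?e t = ?x s" for t
  proof (rule antisym)
    show "?e t \<le> ?x s"
      using decseqD[OF \<open>decseq ?e\<close>, of 0 t] by simp
    \<comment> \<open>Since \<open>indicator B\<close> is at most \<open>?x\<close>, the probability
      of being in \<open>B\<close> at any \<open>n\<close> beyond \<open>t\<close> is at most
      \<open>?e n\<close>, hence at most \<open>?e t\<close>; its limit is \<open>?x s\<close> by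
      optimality.\<close>
    show "?x s \<le> ?e t"
      unfolding opt[symmetric]
    proof (rule LIMSEQ_le_const2[OF reach_prob_tendsto[OF \<pi>]], intro exI allI impI)
      fix n assume "t \<le> n"
      have "measure_pmf.expectation (state_law M s \<pi> n) (indicator B) \<le> ?e n"
        using reach_value_le_max_reach[of 0] by (intro expectation_mono) simp
      also have "\<dots> \<le> ?e t"
        by (rule decseqD[OF \<open>decseq ?e\<close> \<open>t \<le> n\<close>])
      finally show "measure_pmf.expectation (state_law M s \<pi> n) (indicator B) \<le> ?e t" .
    qed
  qed
  have "policy_step M (\<pi> t) ?x s' = ?x s'"
    using e[of "Suc t"] e[of t] s' step unfolding expectation_state_law_Suc
    by (intro expectation_eq_imp_eq_on_support[where f="policy_step M (\<pi> t) ?x" and g="?x"]) auto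
  then have eq: "measure_pmf.expectation (\<pi> t s') (\<lambda>a. measure_pmf.expectation (transition M s' a) ?x) =
      measure_pmf.expectation (\<pi> t s') (\<lambda>_. ?x s')"
    by (simp add: policy_step_def)
  show ?thesis
  proof
    fix a assume a: "a \<in> set_pmf (\<pi> t s')"
    then have "measure_pmf.expectation (transition M s' a) ?x = ?x s'"
      using max_reach_superharmonic act
      by (intro expectation_eq_imp_eq_on_support[OF _ eq]) auto
    then show "a \<in> max_actions M B s'"
      using act[OF a] by (simp add: max_actions_iff)
  qed
qed

end

section \<open>Discounted cost\<close>

text \<open>Costs on finite types are bounded, so a geometric series dominates and sum and integral
  may be exchanged.\<close>

lemma cost_sums:
  fixes M :: "('s::finite, 'a::finite) mdp"
  assumes \<beta>: "0 \<le> \<beta>" "\<beta> < 1"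
  shows "(\<lambda>t. \<beta> ^ t * measure_pmf.expectation (state_law M (initial M) \<pi> t)
      (\<lambda>s. measure_pmf.expectation (\<pi> t s) (c s))) sums cost M c \<beta> \<pi>"
proof -
  interpret path: prob_space "path_measure M (initial M) \<pi>"
    by (rule prob_space_path_measure)
  define C where "C = Max (range (\<lambda>x. \<bar>c (fst x) (snd x)\<bar>))"
  have C: "\<bar>c s a\<bar> \<le> C" for s a
    unfolding C_def by (rule Max_ge) (auto intro: image_eqI[where x="(s, a)"])
  have bound: "\<bar>\<beta> ^ t * c s a\<bar> \<le> \<beta> ^ t * C" for t s a
    using C[of s a] \<beta> by (simp add: abs_mult mult_left_mono)
  have geo: "summable (\<lambda>t. \<beta> ^ t * C)"
    using \<beta> by (intro summable_mult2 summable_geometric) simp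
  let ?f = "\<lambda>t \<omega>. \<beta> ^ t * c (fst (\<omega> t)) (snd (\<omega> t))"
  have meas: "?f t \<in> borel_measurable (path_measure M (initial M) \<pi>)" for t
    by (rule measurable_compose[OF measurable_path_component,
          where g="\<lambda>x. \<beta> ^ t * c (fst x) (snd x)"]) simp
  have int: "integrable (path_measure M (initial M) \<pi>) (?f t)" for t
    by (rule path.integrable_const_bound[where B="\<beta> ^ t * C"]) (use bound meas in auto)
  have "(\<lambda>t. \<integral>\<omega>. ?f t \<omega> \<partial>path_measure M (initial M) \<pi>) sums
      (\<integral>\<omega>. (\<Sum>t. ?f t \<omega>) \<partial>path_measure M (initial M) \<pi>)"
  proof (rule sums_integral[OF int])
    show "AE \<omega> in path_measure M (initial M) \<pi>. summable (\<lambda>t. norm (?f t \<omega>))"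
      by (rule AE_I2, rule summable_comparison_test'[OF geo, of 0]) (use bound in simp)
    show "summable (\<lambda>t. \<integral>\<omega>. norm (?f t \<omega>) \<partial>path_measure M (initial M) \<pi>)"
    proof (rule summable_comparison_test'[OF geo, of 0])
      fix t :: nat
      have "(\<integral>\<omega>. norm (?f t \<omega>) \<partial>path_measure M (initial M) \<pi>) \<le>
          (\<integral>\<omega>. \<beta> ^ t * C \<partial>path_measure M (initial M) \<pi>)"
        by (rule integral_mono) (use int bound in auto)
      then show "norm (\<integral>\<omega>. norm (?f t \<omega>) \<partial>path_measure M (initial M) \<pi>) \<le> \<beta> ^ t * C"
        by (simp add: path.prob_space)
    qed
  qed
  moreover have "(\<integral>\<omega>. ?f t \<omega> \<partial>path_measure M (initial M) \<pi>) =
      \<beta> ^ t * measure_pmf.expectation (state_law M (initial M) \<pi> t)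
        (\<lambda>s. measure_pmf.expectation (\<pi> t s) (c s))" for t
    using integral_path[where f="\<lambda>x. c (fst x) (snd x)" and n=t and M=M and \<pi>=\<pi> and s="initial M"]
    by (simp add: pair_law_def expectation_bind)
  ultimately show ?thesis
    by (simp only: cost_def)
qed

lemma state_law_cong:
  assumes "\<And>t s'. s' \<in> set_pmf (state_law M s \<pi> t) \<Longrightarrow> \<rho> t s' = \<pi> t s'"
  shows "state_law M s \<rho> t = state_law M s \<pi> t"
  by (induction t) (auto intro!: bind_pmf_cong simp: assms)

text \<open>Decision rules matter only in states of positive probability at the given time. This
  permits replacing a reachability-optimal policy by one of the cleaned-up process.\<close>

lemma cost_cong:
  fixes M :: "('s::finite, 'a::finite) mdp"
  assumes eq: "\<And>t s. s \<in> set_pmf (state_law M (initial M) \<pi> t) \<Longrightarrow> \<rho> t s = \<pi> t s"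
    and \<beta>: "0 \<le> \<beta>" "\<beta> < 1"
  shows "cost M c \<beta> \<rho> = cost M c \<beta> \<pi>"
proof -
  have "measure_pmf.expectation (state_law M (initial M) \<pi> t) (\<lambda>s. measure_pmf.expectation (\<rho> t s) (c s)) =
      measure_pmf.expectation (state_law M (initial M) \<pi> t) (\<lambda>s. measure_pmf.expectation (\<pi> t s) (c s))" for t
    by (rule expectation_cong) (simp add: eq)
  then show ?thesis
    using sums_unique2[OF cost_sums[OF \<beta>, of M \<pi> c]] cost_sums[OF \<beta>, of M \<rho> c]
    by (simp add: state_law_cong[OF eq])
qed

section \<open>Resolvents and the cost of stationary policies\<close>

lemma matrix_inv_invertible:
  fixes A :: "'a::semiring_1 ^ 'n ^ 'n"
  assumes "invertible A"
  shows "A ** matrix_inv A = mat 1" "matrix_inv A ** A = mat 1"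
  using someI_ex[OF assms[unfolded invertible_def]] by (auto simp: matrix_inv_def)

lemma policy_step_abs_le:
  fixes M :: "('s::finite, 'a::finite) mdp"
  assumes "\<And>s. \<bar>f s\<bar> \<le> m"
  shows "\<bar>policy_step M d f s\<bar> \<le> m"
proof -
  have 1: "\<bar>measure_pmf.expectation p g\<bar> \<le> m" if "\<And>x. \<bar>g x\<bar> \<le> m" for p :: "'b::finite pmf" and g
    using expectation_mono[of p g "\<lambda>_. m"] expectation_mono[of p "\<lambda>_. - m" g] that
    by (auto simp: abs_le_iff minus_le_iff)
  show ?thesis
    unfolding policy_step_def by (intro 1 assms)
qed

context
  fixes M :: "('s::finite, 'a::finite) mdp" and d :: "'s \<Rightarrow> 'a pmf"
  assumes d: "stationary d \<in> policies M"
begin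

lemma sum_actions: "(\<Sum>a\<in>actions M s. pmf (d s) a * f a) = measure_pmf.expectation (d s) f"
  unfolding expectation_finite
  by (rule sum.mono_neutral_left) (use d in \<open>auto simp: policies_def pmf_eq_0_set_pmf\<close>)

lemma transition_matrix_mult: "(transition_matrix M d *v w) $ s = policy_step M d (($) w) s"
proof -
  have "(transition_matrix M d *v w) $ s =
      (\<Sum>s'\<in>UNIV. \<Sum>a\<in>actions M s. pmf (d s) a * (pmf (transition M s a) s' * w $ s'))"
    by (simp add: transition_matrix_def matrix_vector_mult_def sum_distrib_right mult.assoc)
  also have "\<dots> = (\<Sum>a\<in>actions M s. pmf (d s) a * (\<Sum>s'\<in>UNIV. pmf (transition M s a) s' * w $ s'))"
    by (subst sum.swap) (simp add: sum_distrib_left)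
  finally show ?thesis
    by (simp add: sum_actions policy_step_def expectation_finite[of "transition M _ _"])
qed

lemma discounted_matrix_mult:
  "((mat 1 - \<beta> *\<^sub>R transition_matrix M d) *v w) $ s = w $ s - \<beta> * policy_step M d (($) w) s"
  by (simp add: matrix_vector_mult_diff_rdistrib scaleR_matrix_vector_assoc[symmetric] transition_matrix_mult)

context
  fixes \<beta> :: real
  assumes \<beta>: "0 \<le> \<beta>" "\<beta> < 1"
begin

text \<open>The kernel is trivial: \<open>w = \<beta> P w\<close>, read at a coordinate of maximal
  absolute value \<open>m\<close>, gives \<open>m \<le> \<beta> * m\<close> and so
  \<open>m \<le> 0\<close>.\<close>

lemma invertible_discounted: "invertible (mat 1 - \<beta> *\<^sub>R transition_matrix M d)"
proof -
  have "w = 0" if w: "(mat 1 - \<beta> *\<^sub>R transition_matrix M d) *v w = 0" for w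
  proof -
    define m where "m = Max (range (\<lambda>s. \<bar>w $ s\<bar>))"
    have m: "\<bar>w $ s\<bar> \<le> m" for s
      unfolding m_def by (rule Max_ge) auto
    have "m \<in> range (\<lambda>s. \<bar>w $ s\<bar>)"
      unfolding m_def by (rule Max_in) auto
    then obtain s where s: "m = \<bar>w $ s\<bar>"
      by auto
    have "w $ s = \<beta> * policy_step M d (($) w) s"
      using arg_cong[OF w, of "\<lambda>v. v $ s"] by (simp add: discounted_matrix_mult)
    then have "m \<le> \<beta> * m"
      using policy_step_abs_le[of "($) w" m M d s] m s \<beta> by (simp add: abs_mult mult_left_mono)
    then have "(1 - \<beta>) * m \<le> 0"
      by (simp add: algebra_simps)
    then have "m \<le> 0"
      using \<beta> by (simp add: mult_le_0_iff)
    then show "w = 0"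
      using m by (auto simp: vec_eq_iff) (metis abs_le_zero_iff order_trans)
  qed
  then show ?thesis
    by (simp add: invertible_left_inverse matrix_left_invertible_ker)
qed

lemma resolvent_inverse:
  "(mat 1 - \<beta> *\<^sub>R transition_matrix M d) ** resolvent M \<beta> d = mat 1"
  "resolvent M \<beta> d ** (mat 1 - \<beta> *\<^sub>R transition_matrix M d) = mat 1"
  unfolding resolvent_def by (rule matrix_inv_invertible[OF invertible_discounted])+

text \<open>The vector \<open>w\<close> solves \<open>w = c + \<beta> P w\<close>, so the discounted
  expected costs telescope to its initial entry.\<close>

lemma cost_stationary:
  "cost M c \<beta> (stationary d) = initial_vector M \<bullet> (resolvent M \<beta> d *v cost_vector M c d)"
proof -
  define w where "w = resolvent M \<beta> d *v cost_vector M c d"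
  let ?E = "\<lambda>t. measure_pmf.expectation (state_law M (initial M) (stationary d) t)"
  have "(mat 1 - \<beta> *\<^sub>R transition_matrix M d) *v w = cost_vector M c d"
    unfolding w_def by (simp add: matrix_vector_mul_assoc resolvent_inverse)
  then have c_eq: "measure_pmf.expectation (d s) (c s) = w $ s - \<beta> * policy_step M d (($) w) s" for s
    by (simp add: discounted_matrix_mult[symmetric] cost_vector_def sum_actions)
  have step: "\<beta> ^ t * ?E t (\<lambda>s. measure_pmf.expectation (d s) (c s)) =
      \<beta> ^ t * ?E t (($) w) - \<beta> ^ Suc t * ?E (Suc t) (($) w)" for t
    unfolding c_eq expectation_diff expectation_state_law_Suc by (simp add: algebra_simps)
  define m where "m = Max (range (\<lambda>s. \<bar>w $ s\<bar>))"
  have m: "\<bar>w $ s\<bar> \<le> m" for s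
    unfolding m_def by (rule Max_ge) auto
  \<comment> \<open>The remainder of the telescoping sum: \<open>w\<close> is bounded and
    \<open>\<beta> < 1\<close>.\<close>
  have "(\<lambda>t. \<beta> ^ t * ?E t (($) w)) \<longlonglongrightarrow> 0"
  proof (rule Lim_null_comparison)
    show "\<forall>\<^sub>F t in sequentially. norm (\<beta> ^ t * ?E t (($) w)) \<le> \<beta> ^ t * m"
    proof (intro always_eventually allI)
      fix t
      have "\<bar>?E t (($) w)\<bar> \<le> m"
        using expectation_mono[of _ "($) w" "\<lambda>_. m"] expectation_mono[of _ "\<lambda>_. - m" "($) w"] m
        by (auto simp: abs_le_iff minus_le_iff)
      then show "norm (\<beta> ^ t * ?E t (($) w)) \<le> \<beta> ^ t * m"
        using \<beta> by (simp add: abs_mult mult_left_mono)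
    qed
    show "(\<lambda>t. \<beta> ^ t * m) \<longlonglongrightarrow> 0"
      using \<beta> by (intro tendsto_mult_left_zero LIMSEQ_realpow_zero) auto
  qed
  from telescope_sums'[OF this]
  have "(\<lambda>t. \<beta> ^ t * ?E t (\<lambda>s. measure_pmf.expectation (d s) (c s))) sums (w $ initial M)"
    by (simp only: step) simp
  then have "cost M c \<beta> (stationary d) = w $ initial M"
    by (rule sums_unique2[OF cost_sums[OF \<beta>]])
  then show ?thesis
    by (simp add: w_def initial_vector_def inner_axis')
qed

end

end

section \<open>Exact effect of the perturbation\<close>

context
  fixes M :: "('s::finite, 'a::finite) mdp" and d :: "'s \<Rightarrow> 'a pmf" and e :: real
  assumes d: "stationary d \<in> policies M" and nonneg: "\<And>s a. 0 \<le> perturbed_weight M d e s a"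
begin

lemma perturbed_policy: "stationary (perturbed M d e) \<in> policies M"
proof -
  have "a \<in> actions M s" if "a \<in> set_pmf (perturbed M d e s)" for s a
    using that pmf_perturbed[OF d nonneg, where s=s and a=a]
    by (auto simp: set_pmf_iff perturbed_weight_def pass_def act_def split: if_splits)
  then show ?thesis
    by (auto simp: policies_def)
qed

text \<open>Every passive action gains \<open>e\<close> and every active one loses
  \<open>e * pass_act_ratio M d s\<close>. Taking transition probabilities or costs for
  \<open>f\<close> produces the perturbation matrix and vector.\<close>

lemma sum_perturbed:
  "(\<Sum>a\<in>actions M s. pmf (perturbed M d e s) a * f a) =
    (\<Sum>a\<in>actions M s. pmf (d s) a * f a) +
    e * ((\<Sum>a\<in>pass M d s. f a) - pass_act_ratio M d s * (\<Sum>a\<in>act M d s. f a))"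
proof -
  have split: "actions M s = pass M d s \<union> act M d s" and disj: "pass M d s \<inter> act M d s = {}"
    by (auto simp: pass_def act_def)
  have pass: "pmf (d s) a = 0" if "a \<in> pass M d s" for a
    using that pmf_nonneg[of "d s" a] by (auto simp: pass_def act_def not_less)
  have "(\<Sum>a\<in>actions M s. pmf (perturbed M d e s) a * f a) =
      (\<Sum>a\<in>pass M d s. e * f a) + (\<Sum>a\<in>act M d s. (pmf (d s) a - e * pass_act_ratio M d s) * f a)"
    unfolding split using disj
    by (subst sum.union_disjoint) (auto simp: pmf_perturbed[OF d nonneg] perturbed_weight_def intro!: arg_cong2[where f="(+)"] sum.cong)
  moreover have "(\<Sum>a\<in>actions M s. pmf (d s) a * f a) = (\<Sum>a\<in>act M d s. pmf (d s) a * f a)"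
    unfolding split using disj by (subst sum.union_disjoint) (auto simp: pass)
  ultimately show ?thesis
    by (simp add: left_diff_distrib right_diff_distrib sum_subtractf sum_distrib_left mult.assoc)
qed

lemma transition_matrix_perturbed:
  "transition_matrix M (perturbed M d e) = transition_matrix M d + e *\<^sub>R perturbation_matrix M d"
  by (simp add: vec_eq_iff transition_matrix_def perturbation_matrix_def sum_perturbed)

lemma cost_vector_perturbed:
  "cost_vector M c (perturbed M d e) = cost_vector M c d + e *\<^sub>R perturbation_vector M c d"
  by (simp add: vec_eq_iff cost_vector_def perturbation_vector_def sum_perturbed)

text \<open>The resolvent identity \<open>R' = R + \<beta> e R N R'\<close>, with \<open>N\<close>
  the perturbation matrix, is exact; hence there is no higher-order error, and the perturbed
  resolvent appears in \<open>gamma1\<close> and \<open>gamma2\<close>.\<close>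

lemma cost_perturbed:
  assumes \<beta>: "0 \<le> \<beta>" "\<beta> < 1"
  shows "cost M c \<beta> (stationary (perturbed M d e)) =
    cost M c \<beta> (stationary d) + e * (gamma1 M c \<beta> d e + gamma2 M c \<beta> d e)"
proof -
  let ?A = "mat 1 - \<beta> *\<^sub>R transition_matrix M d"
    and ?A' = "mat 1 - \<beta> *\<^sub>R transition_matrix M (perturbed M d e)"
    and ?R = "resolvent M \<beta> d" and ?R' = "resolvent M \<beta> (perturbed M d e)"
  let ?K = "?R ** perturbation_matrix M d ** ?R'"
  let ?u = "?R' *v cost_vector M c d"
  have "?A = ?A' + (\<beta> * e) *\<^sub>R perturbation_matrix M d"
    by (simp add: transition_matrix_perturbed algebra_simps)
  then have "?A *v ?u = ?A' *v ?u + (\<beta> * e) *\<^sub>R (perturbation_matrix M d *v ?u)"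
    by (simp only: matrix_vector_mult_add_rdistrib scaleR_matrix_vector_assoc)
  also have "?A' *v ?u = cost_vector M c d"
    by (simp add: matrix_vector_mul_assoc resolvent_inverse[OF perturbed_policy \<beta>])
  finally have "?R *v (?A *v ?u) =
      ?R *v (cost_vector M c d + (\<beta> * e) *\<^sub>R (perturbation_matrix M d *v ?u))"
    by simp
  then have u: "?u = ?R *v cost_vector M c d + (\<beta> * e) *\<^sub>R (?K *v cost_vector M c d)"
    unfolding matrix_vector_mul_assoc[of ?R ?A] resolvent_inverse[OF d \<beta>] matrix_vector_mul_lid
      matrix_vector_right_distrib matrix_vector_mult_scaleR
    by (simp add: matrix_vector_mul_assoc matrix_mul_assoc)
  have "cost M c \<beta> (stationary (perturbed M d e)) =
      initial_vector M \<bullet> ?u + e * (initial_vector M \<bullet> (?R' *v perturbation_vector M c d))"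
    by (simp add: cost_stationary[OF perturbed_policy \<beta>] cost_vector_perturbed
        matrix_vector_right_distrib inner_add_right matrix_vector_mult_scaleR)
  also have "initial_vector M \<bullet> ?u =
      initial_vector M \<bullet> (?R *v cost_vector M c d) + \<beta> * e * (initial_vector M \<bullet> (?K *v cost_vector M c d))"
    by (subst u) (simp add: inner_add_right)
  finally show ?thesis
    by (simp add: cost_stationary[OF d \<beta>] gamma1_def gamma2_def algebra_simps)
qed

end

text \<open>In HOL \<open>x / 0 = 0\<close>, so without its guard \<open>e_le\<close> would
  contradict \<open>0 < e\<close> when the two constants sum to \<open>0\<close>. Strict positivity
  in \<open>e_small\<close> gives the perturbed rule full support on the maximal actions.\<close>

theorem theorem1:
  fixes M M' :: "('s::finite, 'a::finite) mdp"
    and B :: "'s set"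
    and c :: "'s \<Rightarrow> 'a \<Rightarrow> real"
    and \<beta> \<epsilon> e :: real
    and d :: "'s \<Rightarrow> 'a pmf"
  assumes B: "\<And>s. s \<in> B \<Longrightarrow> absorbing M s"
    and c: "\<And>s a. 0 \<le> c s a"
    and \<beta>: "0 < \<beta>" "\<beta> < 1"
    and M': "M' = cleaned_up M B"
    and d_det: "deterministic M' d"
    and d_opt: "is_arg_min (cost M' c \<beta>) (\<lambda>\<pi>. \<pi> \<in> policies M') (stationary d)"
    and e: "0 < e"
    and e_small: "\<And>s a. a \<in> actions M' s \<Longrightarrow> 0 < perturbed_weight M' d e s a"
    and \<epsilon>: "0 < \<epsilon>"
    and e_le: "gamma1 M' c \<beta> d e + gamma2 M' c \<beta> d e \<noteq> 0
      \<Longrightarrow> e \<le> \<epsilon> / (gamma1 M' c \<beta> d e + gamma2 M' c \<beta> d e)"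
  shows "stationary (perturbed M' d e) \<in> reach_optimal M B \<and>
    cost M c \<beta> (stationary (perturbed M' d e))
      \<le> (INF \<pi>\<in>reach_optimal M B. cost M c \<beta> \<pi>) + \<epsilon>"
proof -
  let ?d' = "perturbed M' d e" and ?\<gamma> = "gamma1 M' c \<beta> d e + gamma2 M' c \<beta> d e"
  have actions': "actions M' = max_actions M B"
    by (simp add: M' cleaned_up_def)
  interpret absorbing_target M B
  proof
    show "actions M s \<noteq> {}" for s
      using d_det by (auto simp: deterministic_def actions' max_actions_def)
  qed (rule B)
  have \<beta>0: "0 \<le> \<beta>"
    using \<beta> by simp
  \<comment> \<open>The path measure reads only the initial state and the transitions, which
    cleaning up leaves unchanged.\<close>
  have cost_eq: "cost M' c \<beta> = cost M c \<beta>"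
  proof -
    have eq: "transition M' = transition M" "initial M' = initial M"
      by (simp_all add: M' cleaned_up_def)
    show ?thesis
      unfolding cost_def[abs_def] path_measure_def step_def[abs_def] eq ..
  qed
  have d: "stationary d \<in> policies M'"
    using d_opt by (simp add: is_arg_min_def)
  have d_min: "cost M c \<beta> (stationary d) \<le> cost M c \<beta> \<pi>" if "\<pi> \<in> policies M'" for \<pi>
    using d_opt that by (auto simp: is_arg_min_def cost_eq not_less)
  have nonneg: "0 \<le> perturbed_weight M' d e s a" for s a
    using e_small[of a s] by (cases "a \<in> actions M' s") (auto simp: perturbed_weight_def pass_def act_def)
  have d': "stationary ?d' \<in> policies M'"
    by (rule perturbed_policy[OF d nonneg])
  have supp: "set_pmf (?d' s) = max_actions M B s" for s
  proof
    show "set_pmf (?d' s) \<subseteq> max_actions M B s"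
      using d' by (auto simp: policies_def actions')
    show "max_actions M B s \<subseteq> set_pmf (?d' s)"
      using e_small[of _ s] by (force simp: set_pmf_iff pmf_perturbed[OF d nonneg] actions')
  qed
  have reach: "reach_prob M (initial M) B (stationary ?d') = max_reach M B (initial M)"
    by (rule reach_prob_max_actions) (rule supp)
  have d'_pol: "stationary ?d' \<in> policies M"
    using supp by (auto simp: policies_def max_actions_def)
  have opt: "stationary ?d' \<in> reach_optimal M B"
    using d'_pol reach reach_prob_le_max_reach[of _ "initial M"]
    by (auto simp: reach_optimal_def is_arg_max_def not_less)
  have "cost M c \<beta> (stationary d) \<le> cost M c \<beta> \<pi>" if "\<pi> \<in> reach_optimal M B" for \<pi>
  proof -
    have \<pi>: "\<pi> \<in> policies M" and "reach_prob M (initial M) B (stationary ?d') \<le> reach_prob M (initial M) B \<pi>"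
      using that d'_pol by (auto simp: reach_optimal_def is_arg_max_def not_less)
    with reach reach_prob_le_max_reach[OF \<pi>, of "initial M"]
    have \<pi>_opt: "reach_prob M (initial M) B \<pi> = max_reach M B (initial M)"
      by simp
    \<comment> \<open>\<open>\<pi>\<close> may take non-maximal actions, but only in states it does not visit at that time.\<close>
    define \<rho> where "\<rho> t s = (if s \<in> set_pmf (state_law M (initial M) \<pi> t) then \<pi> t s else d s)" for t s
    have "\<rho> \<in> policies M'"
      using reach_optimal_max_actions[OF \<pi> \<pi>_opt] d by (auto simp: policies_def \<rho>_def actions')
    moreover have "cost M c \<beta> \<rho> = cost M c \<beta> \<pi>"
      by (rule cost_cong[OF _ \<beta>0 \<beta>(2)]) (simp add: \<rho>_def)
    ultimately show ?thesis
      using d_min by metis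
  qed
  \<comment> \<open>The infimum is over a nonempty set, as the perturbed policy itself belongs to
    it.\<close>
  then have "cost M c \<beta> (stationary d) \<le> (INF \<pi>\<in>reach_optimal M B. cost M c \<beta> \<pi>)"
    using opt by (intro cINF_greatest) auto
  \<comment> \<open>If \<open>?\<gamma> \<le> 0\<close> the perturbation does not raise the cost;
    otherwise the bound on \<open>e\<close> can be multiplied out.\<close>
  moreover have "e * ?\<gamma> \<le> \<epsilon>"
  proof (cases "?\<gamma> \<le> 0")
    case True
    then have "e * ?\<gamma> \<le> 0"
      using e by (simp add: mult_le_0_iff)
    then show ?thesis using \<epsilon> by simp
  next
    case False
    then show ?thesis using e_le by (simp add: pos_le_divide_eq)
  qed
  moreover have "cost M c \<beta> (stationary ?d') = cost M c \<beta> (stationary d) + e * ?\<gamma>"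
    using cost_perturbed[OF d nonneg \<beta>0 \<beta>(2), of c] by (simp add: cost_eq)
  ultimately show ?thesis
    using opt by simp
qed

end
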